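(* Let $m\ge2$ be an integer and let $f=z_1^m+z_2^m$ and $g=z_1z_2$ be polynomials in $\mathbb{C}[z_1,z_2]$. For every sufficiently small $\varepsilon>0$, the Milnor fibration product map $\Phi:S_\varepsilon\setminus K_{fg}\to T^2$ associated with $f$ and $g$ is a fold map. Furthermore, the indices of the fold points of $\Phi$ are all equal to $1$.
   Context: $S_\varepsilon=\{z\in\mathbb{C}^2\mid \|z\|=\varepsilon\}$ and $K_{fg}=\{z\in S_\varepsilon\mid f(z)g(z)=0\}$. The Milnor fibration product map associated with $f,g$ is the $C^\infty$ map $\Phi:S_\varepsilon\setminus K_{fg}\to S^1\times S^1=T^2$, $\Phi(z)=\left(\frac{f(z)}{|f(z)|},\frac{g(z)}{|g(z)|}\right)$. A point $p$ is a singular point of $\Phi$ if $\mathrm{rank}\,d\Phi_p<2$. "For every sufficiently small $\varepsilon>0$" means: there is $\varepsilon_0>0$ (depending on $f,g$) such that the assertion holds for all $0<\varepsilon\le\varepsilon_0$. Fold point and index: a singular point $p$ of a $C^\infty$ map $\Phi$ from a $3$-manifold to a $2$-manifold is a fold point if there are local coordinates $(x_1,x_2,x_3)$ centered at $p$ and $(y_1,y_2)$ centered at $\Phi(p)$ in which $y_1\circ\Phi=x_3$ and $y_2\circ\Phi$ is one of $x_1^2+x_2^2$, $-x_1^2+x_2^2$, $-x_1^2-x_2^2$. The index is the number $\lambda$ of negative signs, well defined up to replacing $\lambda$ by $2-\lambda$; so index $1$ means the form $-x_1^2+x_2^2$. A fold map is a $C^\infty$ map all of whose singular points are fold points. *)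

theory Defs
  imports "HOL-Analysis.Analysis"
begin

text \<open>
  Manifolds occur below only as embedded submanifolds of a Euclidean space, and smoothness of maps
  on them is understood as local extendability to smooth maps on open subsets of the ambient space.
\<close>

primrec Ck_on :: "nat \<Rightarrow> ('a::real_normed_vector \<Rightarrow> 'b::real_normed_vector) \<Rightarrow> 'a set \<Rightarrow> bool" where
  "Ck_on 0 f S \<longleftrightarrow> continuous_on S f"
| "Ck_on (Suc k) f S \<longleftrightarrow>
     (\<forall>x\<in>S. f differentiable (at x)) \<and> (\<forall>v. Ck_on k (\<lambda>x. frechet_derivative f (at x) v) S)"

text \<open>To be used for open \<open>S\<close> in a finite-dimensional space.\<close>

definition smooth_on :: "'a::real_normed_vector set \<Rightarrow> ('a \<Rightarrow> 'b::real_normed_vector) \<Rightarrow> bool" where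
  "smooth_on S f \<longleftrightarrow> (\<forall>k. Ck_on k f S)"

definition smooth_map :: "'a::euclidean_space set \<Rightarrow> ('a \<Rightarrow> 'b::euclidean_space) \<Rightarrow> bool" where
  "smooth_map A f \<longleftrightarrow>
     (\<forall>p\<in>A. \<exists>W F. open W \<and> p \<in> W \<and> smooth_on W F \<and> (\<forall>q\<in>A \<inter> W. F q = f q))"

text \<open>
  \<open>x\<close> is a system of local coordinates of \<open>M\<close>, defined on the relatively open set \<open>U\<close> and centered
  at \<open>p\<close>; the dimension of \<open>M\<close> is that of the codomain of \<open>x\<close>.
\<close>

definition local_coords ::
    "'a::euclidean_space set \<Rightarrow> 'a \<Rightarrow> 'a set \<Rightarrow> ('a \<Rightarrow> 'b::euclidean_space) \<Rightarrow> bool" where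
  "local_coords M p U x \<longleftrightarrow>
     openin (top_of_set M) U \<and> p \<in> U \<and> x p = 0 \<and>
     inj_on x U \<and> open (x ` U) \<and> smooth_map U x \<and> smooth_map (x ` U) (inv_into U x)"

definition smooth_curves_at :: "'a::euclidean_space set \<Rightarrow> 'a \<Rightarrow> (real \<Rightarrow> 'a) set" where
  "smooth_curves_at M p =
     {\<gamma>. \<gamma> 0 = p \<and> (\<exists>d>0. smooth_on {-d<..<d} \<gamma> \<and> \<gamma> ` {-d<..<d} \<subseteq> M)}"

text \<open>
  The tangent vectors of \<open>M\<close> at \<open>p\<close> are the velocities \<open>\<gamma>'(0)\<close> of smooth curves \<open>\<gamma>\<close> in \<open>M\<close> through \<open>p\<close>,
  and the differential of \<open>\<Phi>\<close> at \<open>p\<close> maps \<open>\<gamma>'(0)\<close> to \<open>(\<Phi> \<circ> \<gamma>)'(0)\<close>. The set below is its image.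
\<close>

definition differential_image ::
    "'a::euclidean_space set \<Rightarrow> ('a \<Rightarrow> 'b::euclidean_space) \<Rightarrow> 'a \<Rightarrow> 'b set" where
  "differential_image M \<Phi> p =
     (\<lambda>\<gamma>. vector_derivative (\<Phi> \<circ> \<gamma>) (at 0)) ` smooth_curves_at M p"

definition rank_differential ::
    "'a::euclidean_space set \<Rightarrow> ('a \<Rightarrow> 'b::euclidean_space) \<Rightarrow> 'a \<Rightarrow> nat" where
  "rank_differential M \<Phi> p = dim (differential_image M \<Phi> p)"

text \<open>From here on \<open>M\<close> is a 3-manifold and \<open>N\<close> a 2-manifold.\<close>

definition singular_point ::
    "'a::euclidean_space set \<Rightarrow> ('a \<Rightarrow> 'b::euclidean_space) \<Rightarrow> 'a \<Rightarrow> bool" where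
  "singular_point M \<Phi> p \<longleftrightarrow> p \<in> M \<and> rank_differential M \<Phi> p < 2"

definition fold_form :: "nat \<Rightarrow> real ^ 3 \<Rightarrow> real" where
  "fold_form l x =
     (if 1 \<le> l then - (x $ 1)\<^sup>2 else (x $ 1)\<^sup>2) + (if 2 \<le> l then - (x $ 2)\<^sup>2 else (x $ 2)\<^sup>2)"

text \<open>The index of a fold point is only determined up to replacing \<open>l\<close> by \<open>2 - l\<close>.\<close>

definition fold_point_of_index ::
    "'a::euclidean_space set \<Rightarrow> 'b::euclidean_space set \<Rightarrow> ('a \<Rightarrow> 'b) \<Rightarrow> 'a \<Rightarrow> nat \<Rightarrow> bool" where
  "fold_point_of_index M N \<Phi> p l \<longleftrightarrow>
     l \<le> 2 \<and> singular_point M \<Phi> p \<and>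
     (\<exists>U V (x :: 'a \<Rightarrow> real ^ 3) (y :: 'b \<Rightarrow> real ^ 2).
        local_coords M p U x \<and> local_coords N (\<Phi> p) V y \<and> \<Phi> ` U \<subseteq> V \<and>
        (\<forall>q\<in>U. y (\<Phi> q) $ 1 = x q $ 3 \<and> y (\<Phi> q) $ 2 = fold_form l (x q)))"

definition fold_point ::
    "'a::euclidean_space set \<Rightarrow> 'b::euclidean_space set \<Rightarrow> ('a \<Rightarrow> 'b) \<Rightarrow> 'a \<Rightarrow> bool" where
  "fold_point M N \<Phi> p \<longleftrightarrow> (\<exists>l. fold_point_of_index M N \<Phi> p l)"

definition fold_map ::
    "'a::euclidean_space set \<Rightarrow> 'b::euclidean_space set \<Rightarrow> ('a \<Rightarrow> 'b) \<Rightarrow> bool" where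
  "fold_map M N \<Phi> \<longleftrightarrow>
     smooth_map M \<Phi> \<and> \<Phi> ` M \<subseteq> N \<and> (\<forall>p. singular_point M \<Phi> p \<longrightarrow> fold_point M N \<Phi> p)"

text \<open>The norm of \<open>complex \<times> complex\<close> is the Euclidean one, so \<open>sphere 0 \<epsilon>\<close> is a round 3-sphere.\<close>

definition milnor_link ::
    "(complex \<times> complex \<Rightarrow> complex) \<Rightarrow> (complex \<times> complex \<Rightarrow> complex) \<Rightarrow> real
      \<Rightarrow> (complex \<times> complex) set" where
  "milnor_link f g \<epsilon> = {z \<in> sphere 0 \<epsilon>. f z * g z = 0}"

definition milnor_product_map ::
    "(complex \<times> complex \<Rightarrow> complex) \<Rightarrow> (complex \<times> complex \<Rightarrow> complex)
      \<Rightarrow> complex \<times> complex \<Rightarrow> complex \<times> complex" where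
  "milnor_product_map f g z =
     (f z / complex_of_real (cmod (f z)), g z / complex_of_real (cmod (g z)))"

definition torus :: "(complex \<times> complex) set" where
  "torus = sphere 0 1 \<times> sphere 0 1"

end

theory Submission
  imports Defs "HOL-Complex_Analysis.Cauchy_Integral_Formula"
begin

text \<open>
  With \<open>z1 ^ m = A\<close> and \<open>z2 ^ m = B\<close>, the rotations \<open>(e^{is} z1, e^{is} z2)\<close> and \<open>(e^{is} z1, e^{-is} z2)\<close>
  and, when \<open>|z1| = |z2|\<close>, the curve \<open>((cos s - sin s) z1, (cos s + sin s) z2)\<close> show that a singular
  point satisfies \<open>A = B\<close>.

  Near such a point \<open>p\<close> put \<open>L1 = Ln (z1 / p1)\<close>, \<open>L2 = Ln (z2 / p2)\<close> and \<open>\<zeta> = (m / 2) (L1 - L2)\<close>. Then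
  \<open>f z = f p * exp ((m / 2) (L1 + L2)) * cosh \<zeta>\<close> and \<open>g z = g p * exp (L1 + L2)\<close>. Hence
  \<open>Im (L1 + L2)\<close> is the angle of \<open>g z / g p\<close>, and the angle of \<open>f z / f p\<close> minus \<open>m / 2\<close> times it is the
  angle of \<open>cosh \<zeta>\<close>, whose tangent is \<open>tanh (Re \<zeta>) * tan (Im \<zeta>)\<close>. On the sphere, \<open>Im (L1 + L2)\<close>,
  \<open>tanh (Re \<zeta>)\<close> and \<open>tan (Im \<zeta>)\<close> are local coordinates, and a product of two coordinates is the
  saddle \<open>- x1\<^sup>2 + x2\<^sup>2\<close> in their half difference and half sum.
\<close>

section \<open>Smooth functions\<close>

lemma Ck_on_Suc_has_derivative:
  assumes "Ck_on (Suc k) f S" "x \<in> S"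
  shows "(f has_derivative frechet_derivative f (at x)) (at x)"
  using assms by (simp add: frechet_derivative_works)

text \<open>Since \<open>S\<close> is open, agreement on \<open>S\<close> is agreement near each of
  its points, so the derivatives agree on \<open>S\<close> as well and the induction can pass to
  them.\<close>

lemma Ck_on_cong:
  assumes "open S" "\<And>x. x \<in> S \<Longrightarrow> f x = g x" "Ck_on k f S"
  shows "Ck_on k g S"
  using assms(2,3)
proof (induction k arbitrary: f g)
  case 0
  then show ?case using continuous_on_cong[of S S f g] by simp
next
  case (Suc k)
  have D: "(g has_derivative frechet_derivative f (at x)) (at x)" if "x \<in> S" for x
    by (rule has_derivative_transform_within_open[OF Ck_on_Suc_has_derivative[OF Suc.prems(2) that]
          assms(1) that Suc.prems(1)])
  have "Ck_on k (\<lambda>x. frechet_derivative g (at x) v) S" for v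
  proof (rule Suc.IH)
    show "frechet_derivative f (at x) v = frechet_derivative g (at x) v" if "x \<in> S" for x
      by (simp only: frechet_derivative_at[OF D[OF that]])
    show "Ck_on k (\<lambda>x. frechet_derivative f (at x) v) S"
      using Suc.prems(2) by simp
  qed
  moreover have "g differentiable (at x)" if "x \<in> S" for x
    using D[OF that] by (rule differentiableI)
  ultimately show ?case by simp
qed

text \<open>Lets an induction step use a computed derivative \<open>D\<close> in place of the term
  \<open>frechet_derivative\<close>.\<close>

lemma Ck_on_SucI:
  assumes "open S" "\<And>x. x \<in> S \<Longrightarrow> (f has_derivative D x) (at x)" "\<And>v. Ck_on k (\<lambda>x. D x v) S"
  shows "Ck_on (Suc k) f S"
proof -
  have "D x = frechet_derivative f (at x)" if "x \<in> S" for x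
    using frechet_derivative_at[OF assms(2)[OF that]] .
  then have "Ck_on k (\<lambda>x. frechet_derivative f (at x) v) S" for v
    by (intro Ck_on_cong[OF assms(1) _ assms(3)[of v]]) auto
  with assms(2) show ?thesis by (auto simp: differentiable_def)
qed

lemma Ck_on_SucD: "Ck_on (Suc k) f S \<Longrightarrow> Ck_on k f S"
proof (induction k arbitrary: f)
  case 0
  then show ?case
    by (auto intro!: differentiable_imp_continuous_on simp: differentiable_on_def differentiable_at_withinI)
next
  case (Suc k)
  show ?case
    using Suc.prems Suc.IH unfolding Ck_on.simps(2)[of "Suc k"] Ck_on.simps(2)[of k f] by blast
qed

lemma Ck_on_const: "open S \<Longrightarrow> Ck_on k (\<lambda>x. c) S"
  by (induction k arbitrary: c) (auto intro!: Ck_on_SucI[where D = "\<lambda>x v. 0"] simp del: Ck_on.simps(2))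

lemma Ck_on_add:
  assumes "open S" "Ck_on k f S" "Ck_on k g S"
  shows "Ck_on k (\<lambda>x. f x + g x) S"
  using assms(2,3)
proof (induction k arbitrary: f g)
  case 0
  then show ?case by (simp add: continuous_on_add)
next
  case (Suc k)
  show ?case
  proof (rule Ck_on_SucI[OF assms(1)])
    show "((\<lambda>x. f x + g x) has_derivative
        (\<lambda>v. frechet_derivative f (at x) v + frechet_derivative g (at x) v)) (at x)" if "x \<in> S" for x
      by (intro has_derivative_add Ck_on_Suc_has_derivative[OF Suc.prems(1) that]
          Ck_on_Suc_has_derivative[OF Suc.prems(2) that])
    show "Ck_on k (\<lambda>x. frechet_derivative f (at x) v + frechet_derivative g (at x) v) S" for v
      using Suc.prems by (intro Suc.IH) simp_all
  qed
qed

text \<open>The product rule pairs each factor with a derivative of the other, so the induction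
  hypothesis applies once the undifferentiated factor is weakened by one order. Stated for any
  bilinear map, it serves both \<open>smooth_on_mult\<close> and
  \<open>smooth_on_scaleR\<close>.\<close>

lemma Ck_on_bounded_bilinear:
  assumes "bounded_bilinear prd" "open S" "Ck_on k f S" "Ck_on k g S"
  shows "Ck_on k (\<lambda>x. prd (f x) (g x)) S"
  using assms(3,4)
proof (induction k arbitrary: f g)
  case 0
  then show ?case by (simp add: bounded_bilinear.continuous_on[OF assms(1)])
next
  case (Suc k)
  show ?case
  proof (rule Ck_on_SucI[OF assms(2)])
    show "((\<lambda>x. prd (f x) (g x)) has_derivative
        (\<lambda>v. prd (f x) (frechet_derivative g (at x) v) + prd (frechet_derivative f (at x) v) (g x))) (at x)"
      if "x \<in> S" for x
      by (rule bounded_bilinear.FDERIV[OF assms(1) Ck_on_Suc_has_derivative[OF Suc.prems(1) that]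
          Ck_on_Suc_has_derivative[OF Suc.prems(2) that]])
    show "Ck_on k (\<lambda>x. prd (f x) (frechet_derivative g (at x) v) +
        prd (frechet_derivative f (at x) v) (g x)) S" for v
    proof (rule Ck_on_add[OF assms(2)])
      show "Ck_on k (\<lambda>x. prd (f x) (frechet_derivative g (at x) v)) S"
        using Suc.prems by (intro Suc.IH Ck_on_SucD[of k f]) simp_all
      show "Ck_on k (\<lambda>x. prd (frechet_derivative f (at x) v) (g x)) S"
        using Suc.prems by (intro Suc.IH Ck_on_SucD[of k g]) simp_all
    qed
  qed
qed

lemma Ck_on_bounded_linear_compose:
  assumes "bounded_linear L" "open S" "Ck_on k f S"
  shows "Ck_on k (\<lambda>x. L (f x)) S"
  using assms(3)
proof (induction k arbitrary: f)
  case 0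
  then show ?case by (simp add: bounded_linear.continuous_on[OF assms(1)])
next
  case (Suc k)
  show ?case
  proof (rule Ck_on_SucI[OF assms(2)])
    show "((\<lambda>x. L (f x)) has_derivative (\<lambda>v. L (frechet_derivative f (at x) v))) (at x)"
      if "x \<in> S" for x
      by (rule bounded_linear.has_derivative[OF assms(1) Ck_on_Suc_has_derivative[OF Suc.prems that]])
    show "Ck_on k (\<lambda>x. L (frechet_derivative f (at x) v)) S" for v
      using Suc.prems by (intro Suc.IH) simp
  qed
qed

lemma Ck_on_id: "open S \<Longrightarrow> Ck_on k (\<lambda>x. x) S"
  by (cases k) (auto intro!: Ck_on_SucI[where D = "\<lambda>x v. v"] Ck_on_const simp del: Ck_on.simps(2))

text \<open>For holomorphic \<open>h\<close> the chain rule is multiplication by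
  \<open>deriv h (g x)\<close>, and \<open>deriv h\<close> is again holomorphic on \<open>T\<close>,
  so the induction closes. Real elementary functions are reached below through their complex
  counterparts.\<close>

lemma Ck_on_holomorphic_compose:
  assumes "open T" "h holomorphic_on T" "open S" "g ` S \<subseteq> T" "Ck_on k g S"
  shows "Ck_on k (\<lambda>x. h (g x)) S"
  using assms(2,5)
proof (induction k arbitrary: h)
  case 0
  have "continuous_on S g"
    using 0(2) by simp
  then show ?case
    using continuous_on_compose2[OF holomorphic_on_imp_continuous_on[OF 0(1)] _ assms(4)] by simp
next
  case (Suc k)
  have "((\<lambda>x. h (g x)) has_derivative (\<lambda>v. deriv h (g x) * frechet_derivative g (at x) v)) (at x)"
    if "x \<in> S" for x
  proof (rule has_derivative_compose[OF Ck_on_Suc_has_derivative[OF Suc.prems(2) that]])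
    show "(h has_derivative (*) (deriv h (g x))) (at (g x))"
      using holomorphic_derivI[OF Suc.prems(1) assms(1)] assms(4) that
      by (auto simp: has_field_derivative_def)
  qed
  moreover have "Ck_on k (\<lambda>x. deriv h (g x) * frechet_derivative g (at x) v) S" for v
  proof (rule Ck_on_bounded_bilinear[OF bounded_bilinear_mult assms(3)])
    show "Ck_on k (\<lambda>x. deriv h (g x)) S"
      by (rule Suc.IH[OF holomorphic_deriv[OF Suc.prems(1) assms(1)] Ck_on_SucD[OF Suc.prems(2)]])
    show "Ck_on k (\<lambda>x. frechet_derivative g (at x) v) S"
      using Suc.prems(2) by simp
  qed
  ultimately show ?case by (rule Ck_on_SucI[OF assms(3)])
qed

section \<open>Rules for smooth functions with complex and vector values\<close>

lemma smooth_on_const [intro, simp]: "open S \<Longrightarrow> smooth_on S (\<lambda>x. c)"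
  and smooth_on_id [intro, simp]: "open S \<Longrightarrow> smooth_on S (\<lambda>x. x)"
  by (auto simp: smooth_on_def Ck_on_const Ck_on_id)

lemma smooth_on_cong:
  assumes "open S" "\<And>x. x \<in> S \<Longrightarrow> f x = g x" "smooth_on S f"
  shows "smooth_on S g"
  using assms by (auto simp: smooth_on_def intro: Ck_on_cong[of S f g])

lemma smooth_on_imp_continuous_on: "smooth_on S f \<Longrightarrow> continuous_on S f"
  by (metis Ck_on.simps(1) smooth_on_def)

lemma smooth_on_bounded_linear_compose:
  assumes "bounded_linear L" "open S" "smooth_on S f"
  shows "smooth_on S (\<lambda>x. L (f x))"
  using assms(3) unfolding smooth_on_def by (intro allI Ck_on_bounded_linear_compose[OF assms(1,2)]) simp_all

lemma smooth_on_holomorphic_compose: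
  assumes "h holomorphic_on T" "open T" "open S" "smooth_on S g" "\<And>x. x \<in> S \<Longrightarrow> g x \<in> T"
  shows "smooth_on S (\<lambda>x. h (g x))"
  unfolding smooth_on_def
proof
  have "g ` S \<subseteq> T"
    using assms(5) by blast
  then show "Ck_on k (\<lambda>x. h (g x)) S" for k
    using assms(4) by (intro Ck_on_holomorphic_compose[OF assms(2,1,3)]) (simp_all add: smooth_on_def)
qed

lemma smooth_on_add:
  assumes "open S" "smooth_on S f" "smooth_on S g"
  shows "smooth_on S (\<lambda>x. f x + g x)"
  using assms by (auto simp: smooth_on_def intro: Ck_on_add)

lemma smooth_on_mult:
  fixes f g :: "_ \<Rightarrow> 'a::real_normed_algebra"
  assumes "open S" "smooth_on S f" "smooth_on S g"
  shows "smooth_on S (\<lambda>x. f x * g x)"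
  using assms(2,3) unfolding smooth_on_def by (intro allI Ck_on_bounded_bilinear[OF bounded_bilinear_mult assms(1)]) simp_all

lemma smooth_on_scaleR:
  assumes "open S" "smooth_on S f" "smooth_on S g"
  shows "smooth_on S (\<lambda>x. f x *\<^sub>R g x)"
  using assms(2,3) unfolding smooth_on_def by (intro allI Ck_on_bounded_bilinear[OF bounded_bilinear_scaleR assms(1)]) simp_all

lemma smooth_on_minus:
  assumes "open S" "smooth_on S f"
  shows "smooth_on S (\<lambda>x. - f x)"
  using assms by (rule smooth_on_bounded_linear_compose[OF bounded_linear_minus[OF bounded_linear_ident]])

lemma smooth_on_diff:
  assumes "open S" "smooth_on S f" "smooth_on S g"
  shows "smooth_on S (\<lambda>x. f x - g x)"
  using smooth_on_add[OF assms(1,2) smooth_on_minus[OF assms(1,3)]] by simp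

lemma smooth_on_Pair:
  assumes "open S" "smooth_on S f" "smooth_on S g"
  shows "smooth_on S (\<lambda>x. (f x, g x))"
proof -
  have "smooth_on S (\<lambda>x. (f x, 0) + (0, g x))"
    by (rule smooth_on_add[OF assms(1) smooth_on_bounded_linear_compose[OF _ assms(1,2)]
            smooth_on_bounded_linear_compose[OF _ assms(1,3)]])
      (simp_all add: bounded_linear_Pair bounded_linear_zero bounded_linear_ident)
  then show ?thesis by simp
qed

lemma smooth_on_power:
  fixes f :: "_ \<Rightarrow> 'a::real_normed_algebra_1"
  assumes "open S" "smooth_on S f"
  shows "smooth_on S (\<lambda>x. f x ^ n)"
  by (induction n) (simp_all add: assms smooth_on_mult)

lemma smooth_on_inverse:
  fixes f :: "_ \<Rightarrow> complex"
  assumes "open S" "smooth_on S f" "\<And>x. x \<in> S \<Longrightarrow> f x \<noteq> 0"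
  shows "smooth_on S (\<lambda>x. inverse (f x))"
proof (rule smooth_on_holomorphic_compose[where h = inverse and g = f and T = "-{0}"])
  show "inverse holomorphic_on (-{0::complex})"
    by (rule holomorphic_on_inverse[OF holomorphic_on_ident]) simp
qed (use assms in \<open>simp_all add: open_Compl closed_nonpos_Reals_complex\<close>)

lemma smooth_on_divide:
  fixes f g :: "_ \<Rightarrow> complex"
  assumes "open S" "smooth_on S f" "smooth_on S g" "\<And>x. x \<in> S \<Longrightarrow> g x \<noteq> 0"
  shows "smooth_on S (\<lambda>x. f x / g x)"
  unfolding divide_inverse by (intro smooth_on_mult smooth_on_inverse assms)

lemma smooth_on_exp:
  fixes f :: "_ \<Rightarrow> complex"
  assumes "open S" "smooth_on S f"
  shows "smooth_on S (\<lambda>x. exp (f x))"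
  by (rule smooth_on_holomorphic_compose[OF holomorphic_on_exp open_UNIV assms]) simp

lemma smooth_on_Ln:
  assumes "open S" "smooth_on S f" "\<And>x. x \<in> S \<Longrightarrow> f x \<notin> \<real>\<^sub>\<le>\<^sub>0"
  shows "smooth_on S (\<lambda>x. Ln (f x))"
proof (rule smooth_on_holomorphic_compose[where h = Ln and g = f and T = "-\<real>\<^sub>\<le>\<^sub>0"])
  show "Ln holomorphic_on -\<real>\<^sub>\<le>\<^sub>0"
    by (rule holomorphic_on_Ln) simp
qed (use assms in \<open>simp_all add: open_Compl closed_nonpos_Reals_complex\<close>)

lemmas smooth_on_Re = smooth_on_bounded_linear_compose[OF bounded_linear_Re]
  and smooth_on_Im = smooth_on_bounded_linear_compose[OF bounded_linear_Im]
  and smooth_on_cnj = smooth_on_bounded_linear_compose[OF bounded_linear_cnj]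
  and smooth_on_fst = smooth_on_bounded_linear_compose[OF bounded_linear_fst]
  and smooth_on_snd = smooth_on_bounded_linear_compose[OF bounded_linear_snd]
  and smooth_on_vec_nth = smooth_on_bounded_linear_compose[OF bounded_linear_vec_nth]

lemma smooth_on_of_real:
  fixes f :: "_ \<Rightarrow> real"
  assumes "open S" "smooth_on S f"
  shows "smooth_on S (\<lambda>x. complex_of_real (f x))"
  using assms by (rule smooth_on_bounded_linear_compose[OF bounded_linear_of_real])

lemma smooth_on_vector:
  fixes f :: "_ \<Rightarrow> real ^ 'n"
  assumes "open S" "\<And>i. smooth_on S (\<lambda>x. f x $ i)"
  shows "smooth_on S f"
proof -
  have *: "smooth_on S (\<lambda>x. \<Sum>i\<in>I. f x $ i *\<^sub>R (axis i 1 :: real ^ 'n))" if "finite I" for I :: "'n set"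
    using that by (induction I) (simp_all add: assms smooth_on_add smooth_on_scaleR)
  have "(\<Sum>i\<in>UNIV. f x $ i *\<^sub>R axis i 1) = f x" for x
    using basis_expansion[of "f x"] by (simp add: scalar_mult_eq_scaleR)
  with *[of UNIV] show ?thesis by simp
qed

text \<open>Away from \<open>0\<close>, the modulus of \<open>w\<close> is \<open>csqrt (w * cnj w)\<close> with \<open>w * cnj w\<close> off the branch cut.\<close>

lemma smooth_on_normalize:
  assumes "open S" "smooth_on S f" "\<And>x. x \<in> S \<Longrightarrow> f x \<noteq> 0"
  shows "smooth_on S (\<lambda>x. f x / complex_of_real (cmod (f x)))"
proof -
  have *: "f x * cnj (f x) = complex_of_real ((cmod (f x))\<^sup>2)" for x
    using complex_norm_square[of "f x"] by simp
  have "smooth_on S (\<lambda>x. csqrt (f x * cnj (f x)))"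
  proof (rule smooth_on_holomorphic_compose[OF holomorphic_on_csqrt _ assms(1)])
    show "smooth_on S (\<lambda>x. f x * cnj (f x))"
      by (intro smooth_on_mult smooth_on_cnj assms)
    show "f x * cnj (f x) \<in> -\<real>\<^sub>\<le>\<^sub>0" if "x \<in> S" for x
      using assms(3)[OF that] by (simp add: * complex_nonpos_Reals_iff)
  qed (simp add: open_Compl closed_nonpos_Reals_complex)
  moreover have "csqrt (f x * cnj (f x)) = complex_of_real (cmod (f x))" for x
    unfolding * by (subst csqrt_of_real_nonneg) simp_all
  ultimately have "smooth_on S (\<lambda>x. complex_of_real (cmod (f x)))"
    by simp
  then show ?thesis
    by (intro smooth_on_divide assms) (use assms(3) in simp_all)
qed

lemma Ck_on_subset: "Ck_on k f S \<Longrightarrow> T \<subseteq> S \<Longrightarrow> Ck_on k f T"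
  by (induction k arbitrary: f) (auto intro: continuous_on_subset)

lemma smooth_on_subset: "smooth_on S f \<Longrightarrow> T \<subseteq> S \<Longrightarrow> smooth_on T f"
  unfolding smooth_on_def using Ck_on_subset by blast

section \<open>Smoothness of real elementary functions\<close>

lemma smooth_on_cis:
  assumes "open S" "smooth_on S f"
  shows "smooth_on S (\<lambda>x. cis (f x))"
  unfolding cis_conv_exp by (intro smooth_on_exp smooth_on_mult smooth_on_of_real smooth_on_const assms)

lemma smooth_on_cos: "smooth_on UNIV (\<lambda>s::real. cos s)"
  using smooth_on_Re[OF _ smooth_on_cis[OF _ smooth_on_id], of UNIV] by simp

lemma smooth_on_sin: "smooth_on UNIV (\<lambda>s::real. sin s)"
  using smooth_on_Im[OF _ smooth_on_cis[OF _ smooth_on_id], of UNIV] by simp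

lemma smooth_on_exp_real:
  fixes f :: "_ \<Rightarrow> real"
  assumes "open S" "smooth_on S f"
  shows "smooth_on S (\<lambda>x. exp (f x))"
  using smooth_on_Re[OF assms(1) smooth_on_exp[OF assms(1) smooth_on_of_real[OF assms]]]
  by (simp add: exp_of_real)

lemma smooth_on_ln_real:
  fixes f :: "_ \<Rightarrow> real"
  assumes "open S" "smooth_on S f" "\<And>x. x \<in> S \<Longrightarrow> f x > 0"
  shows "smooth_on S (\<lambda>x. ln (f x))"
proof (rule smooth_on_cong[OF assms(1)])
  show "smooth_on S (\<lambda>x. Re (Ln (complex_of_real (f x))))"
    using assms(3) by (intro smooth_on_Re smooth_on_Ln smooth_on_of_real assms) (force simp: complex_nonpos_Reals_iff)
  show "Re (Ln (complex_of_real (f x))) = ln (f x)" if "x \<in> S" for x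
    using assms(3)[OF that] by (simp add: Ln_of_real)
qed

lemma smooth_on_divide_real:
  fixes f g :: "_ \<Rightarrow> real"
  assumes "open S" "smooth_on S f" "smooth_on S g" "\<And>x. x \<in> S \<Longrightarrow> g x \<noteq> 0"
  shows "smooth_on S (\<lambda>x. f x / g x)"
proof -
  have "smooth_on S (\<lambda>x. Re (of_real (f x) / of_real (g x)))"
    using assms(4) by (intro smooth_on_Re smooth_on_divide smooth_on_of_real assms) simp
  then show ?thesis
    by (simp flip: of_real_divide)
qed

lemma smooth_on_cosh_real:
  fixes f :: "_ \<Rightarrow> real"
  assumes "open S" "smooth_on S f"
  shows "smooth_on S (\<lambda>x. cosh (f x))"
  unfolding cosh_field_def
  by (intro smooth_on_divide_real smooth_on_add smooth_on_exp_real smooth_on_minus smooth_on_const assms) simp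

lemma smooth_on_tanh_real:
  fixes f :: "_ \<Rightarrow> real"
  assumes "open S" "smooth_on S f"
  shows "smooth_on S (\<lambda>x. tanh (f x))"
  unfolding tanh_def sinh_field_def
  by (intro smooth_on_divide_real smooth_on_diff smooth_on_exp_real smooth_on_minus smooth_on_const
      smooth_on_cosh_real assms) simp_all

lemma smooth_on_artanh_real:
  fixes f :: "_ \<Rightarrow> real"
  assumes "open S" "smooth_on S f" "\<And>x. x \<in> S \<Longrightarrow> \<bar>f x\<bar> < 1"
  shows "smooth_on S (\<lambda>x. artanh (f x))"
  unfolding artanh_def
proof (intro smooth_on_divide_real smooth_on_ln_real smooth_on_add smooth_on_diff smooth_on_const assms)
  show "(1 + f x) / (1 - f x) > 0" "1 - f x \<noteq> 0" if "x \<in> S" for x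
    using assms(3)[OF that] by (auto simp: abs_less_iff)
qed simp

lemma smooth_on_tan_real:
  fixes f :: "_ \<Rightarrow> real"
  assumes "open S" "smooth_on S f" "\<And>x. x \<in> S \<Longrightarrow> cos (f x) \<noteq> 0"
  shows "smooth_on S (\<lambda>x. tan (f x))"
proof -
  have "smooth_on S (\<lambda>x. Im (cis (f x)) / Re (cis (f x)))"
    using assms(3) by (intro smooth_on_divide_real smooth_on_Im smooth_on_Re smooth_on_cis assms) simp
  then show ?thesis
    by (simp add: tan_def)
qed

lemma smooth_on_arctan:
  assumes "open S" "smooth_on S f"
  shows "smooth_on S (\<lambda>x. arctan (f x))"
proof -
  have "smooth_on S (\<lambda>x. Arctan (complex_of_real (f x)))"
  proof (rule smooth_on_holomorphic_compose[where h = Arctan])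
    \<comment> \<open>The branch cuts of \<open>Arctan\<close> lie on the imaginary axis outside
      this strip, which contains the real line.\<close>
    show "Arctan holomorphic_on {z. \<bar>Im z\<bar> < 1}"
      by (rule holomorphic_on_Arctan) simp
    show "open {z. \<bar>Im z\<bar> < 1}"
      by (intro open_Collect_less continuous_intros)
    show "smooth_on S (\<lambda>x. complex_of_real (f x))"
      by (intro smooth_on_of_real assms)
  qed (simp_all add: assms(1))
  then have "smooth_on S (\<lambda>x. Re (Arctan (complex_of_real (f x))))"
    by (rule smooth_on_Re[OF assms(1)])
  then show ?thesis
    by (simp add: arctan_eq_Re_Arctan)
qed

lemma smooth_on_vector2:
  fixes a b :: "_ \<Rightarrow> real"
  assumes "open S" "smooth_on S a" "smooth_on S b"
  shows "smooth_on S (\<lambda>x. vector [a x, b x] :: real ^ 2)"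
proof (rule smooth_on_vector[OF assms(1)])
  show "smooth_on S (\<lambda>x. (vector [a x, b x] :: real ^ 2) $ i)" for i
    using assms exhaust_2[of i] by auto
qed

lemma smooth_on_vector3:
  fixes a b c :: "_ \<Rightarrow> real"
  assumes "open S" "smooth_on S a" "smooth_on S b" "smooth_on S c"
  shows "smooth_on S (\<lambda>x. vector [a x, b x, c x] :: real ^ 3)"
proof (rule smooth_on_vector[OF assms(1)])
  show "smooth_on S (\<lambda>x. (vector [a x, b x, c x] :: real ^ 3) $ i)" for i
    using assms exhaust_3[of i] by auto
qed

section \<open>Singular points\<close>

text \<open>The quotient \<open>F' / F s\<close> is the logarithmic derivative: its real part is the
  growth rate of the modulus and its imaginary part the angular velocity. Normalizing keeps only the
  latter.\<close>

lemma has_vector_derivative_normalize: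
  fixes F :: "real \<Rightarrow> complex"
  assumes F: "(F has_vector_derivative F') (at s)" and nz: "F s \<noteq> 0"
  shows "((\<lambda>t. F t / complex_of_real (cmod (F t))) has_vector_derivative
     \<i> * complex_of_real (Im (F' / F s)) * (F s / complex_of_real (cmod (F s)))) (at s)"
proof -
  define n where "n = cmod (F s)"
  have n: "n > 0"
    using nz by (simp add: n_def)
  have "((\<lambda>t. norm (F t)) has_derivative (\<lambda>h. (h *\<^sub>R F') \<bullet> sgn (F s))) (at s)"
    using has_derivative_compose[OF F[unfolded has_vector_derivative_def] has_derivative_norm[OF nz]] .
  moreover have "(\<lambda>h. (h *\<^sub>R F') \<bullet> sgn (F s)) = (*) (F' \<bullet> sgn (F s))"
    by (simp add: fun_eq_iff mult.commute)
  ultimately have N: "((\<lambda>t. norm (F t)) has_real_derivative F' \<bullet> sgn (F s)) (at s)"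
    by (simp add: has_field_derivative_def)
  have "((\<lambda>t. inverse (norm (F t))) has_real_derivative - (inverse n * (F' \<bullet> sgn (F s)) * inverse n)) (at s)"
    using DERIV_inverse'[OF N] nz by (simp add: n_def)
  from has_vector_derivative_scaleR[OF this F]
  have "((\<lambda>t. F t / complex_of_real (cmod (F t))) has_vector_derivative
      (inverse n *\<^sub>R F' + (- (inverse n * (F' \<bullet> sgn (F s)) * inverse n)) *\<^sub>R F s)) (at s)"
    by (simp add: scaleR_conv_of_real divide_inverse mult.commute n_def)
  moreover have "inverse n *\<^sub>R F' + (- (inverse n * (F' \<bullet> sgn (F s)) * inverse n)) *\<^sub>R F s
      = \<i> * complex_of_real (Im (F' / F s)) * (F s / complex_of_real n)"
  proof -
    \<comment> \<open>\<open>r\<close> is the growth rate of the modulus and \<open>j\<close> the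
      angular velocity; the terms with \<open>r\<close> cancel below.\<close>
    define r j where "r = Re (F' / F s)" and "j = Im (F' / F s)"
    have "r = (Re F' * Re (F s) + Im F' * Im (F s)) / n\<^sup>2"
      by (simp add: r_def Re_divide n_def cmod_power2)
    then have r: "F' \<bullet> sgn (F s) = r * n"
      using n by (simp add: inner_complex_def sgn_eq n_def[symmetric] power2_eq_square field_simps)
    have F': "F' = (complex_of_real r + \<i> * complex_of_real j) * F s"
      unfolding r_def j_def using nz by (metis complex_eq nonzero_divide_eq_eq)
    have "inverse n *\<^sub>R F' + (- (inverse n * (r * n) * inverse n)) *\<^sub>R F s
        = \<i> * complex_of_real j * (F s / complex_of_real n)"
      unfolding F' using n by (simp add: scaleR_conv_of_real field_simps)
    then show ?thesis
      unfolding r j_def .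
  qed
  ultimately show ?thesis
    by (simp add: n_def)
qed

text \<open>By continuity a curve starting off the zero set of \<open>h\<close> stays off it for a
  short time. Thus curves defined for all times on the whole sphere can be used as test curves in
  the complement of the link.\<close>

lemma smooth_curves_at_diffI:
  fixes h :: "'a::euclidean_space \<Rightarrow> 'b::real_normed_vector"
  assumes "smooth_on UNIV \<gamma>" "\<gamma> 0 = p" "\<And>s. \<gamma> s \<in> S" "continuous_on UNIV h" "h p \<noteq> 0"
  shows "\<gamma> \<in> smooth_curves_at (S - {z \<in> S. h z = 0}) p"
proof -
  have "continuous_on UNIV (\<lambda>s. h (\<gamma> s))"
    using continuous_on_compose2[OF assms(4) smooth_on_imp_continuous_on[OF assms(1)]] by simp
  then have "open {s. h (\<gamma> s) \<noteq> 0}"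
    by (intro open_Collect_neq continuous_on_const)
  moreover have "0 \<in> {s. h (\<gamma> s) \<noteq> 0}"
    using assms by simp
  ultimately obtain d where d: "d > 0" "ball 0 d \<subseteq> {s. h (\<gamma> s) \<noteq> 0}"
    by (meson open_contains_ball)
  then have "h (\<gamma> s) \<noteq> 0" if "s \<in> {-d<..<d}" for s
    using that by (auto simp: subset_iff dist_real_def)
  with d(1) assms(2,3) smooth_on_subset[OF assms(1) subset_UNIV] show ?thesis
    unfolding smooth_curves_at_def by blast
qed

lemma has_vector_derivative_cis_0: "((\<lambda>s. cis (c * s)) has_vector_derivative \<i> * of_real c) (at 0)"
  unfolding has_vector_derivative_def
  by (rule derivative_eq_intros refl)+ (simp add: fun_eq_iff scaleR_conv_of_real)

section \<open>The pair \<open>f\<close>, \<open>g\<close> and a necessary condition for singular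
  points\<close>

locale product_pair =
  fixes m :: nat and f g :: "complex \<times> complex \<Rightarrow> complex"
  assumes m: "m \<ge> 2"
    and f: "f = (\<lambda>(z1, z2). z1 ^ m + z2 ^ m)"
    and g: "g = (\<lambda>(z1, z2). z1 * z2)"
begin

abbreviation "M \<epsilon> \<equiv> sphere 0 \<epsilon> - milnor_link f g \<epsilon>"

abbreviation "\<Phi> \<equiv> milnor_product_map f g"

lemma smooth_on_f: "smooth_on UNIV f"
  and smooth_on_g: "smooth_on UNIV g"
  unfolding f g case_prod_unfold
  by (intro smooth_on_add smooth_on_mult smooth_on_power smooth_on_fst smooth_on_snd smooth_on_id open_UNIV)+

lemma smooth_map_Phi: "smooth_map (M \<epsilon>) \<Phi>"
  unfolding smooth_map_def
proof (intro ballI exI conjI)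
  fix p assume p: "p \<in> M \<epsilon>"
  define W where "W = {z. f z * g z \<noteq> 0}"
  show "open W"
    unfolding W_def using smooth_on_imp_continuous_on[OF smooth_on_f] smooth_on_imp_continuous_on[OF smooth_on_g]
    by (intro open_Collect_neq continuous_intros)
  show "p \<in> W"
    using p by (auto simp: W_def milnor_link_def)
  show "smooth_on W \<Phi>"
    unfolding milnor_product_map_def using \<open>open W\<close>
    by (intro smooth_on_Pair smooth_on_normalize smooth_on_subset[OF smooth_on_f] smooth_on_subset[OF smooth_on_g])
      (auto simp: W_def)
qed auto

lemma Phi_in_torus: "z \<in> M \<epsilon> \<Longrightarrow> \<Phi> z \<in> torus"
  by (auto simp: milnor_product_map_def torus_def milnor_link_def norm_divide)

text \<open>The test curve is \<open>(z1 * a s, z2 * b s)\<close>, kept on the sphere by the last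
  hypothesis. In each circle factor the angular velocity of its image is the imaginary part of the
  logarithmic derivative of \<open>f\<close> or \<open>g\<close> along the curve.\<close>

lemma velocity_in_differential_image:
  assumes p: "(z1, z2) \<in> M \<epsilon>"
    and a: "smooth_on UNIV a" "a 0 = 1" "(a has_vector_derivative a') (at 0)"
    and b: "smooth_on UNIV b" "b 0 = 1" "(b has_vector_derivative b') (at 0)"
    and sphere: "\<And>s. (cmod z1 * cmod (a s))\<^sup>2 + (cmod z2 * cmod (b s))\<^sup>2 = (cmod z1)\<^sup>2 + (cmod z2)\<^sup>2"
  shows "(\<i> * of_real (Im (of_nat m * (z1 ^ m * a' + z2 ^ m * b') / (z1 ^ m + z2 ^ m))) * fst (\<Phi> (z1, z2)),
      \<i> * of_real (Im (a' + b')) * snd (\<Phi> (z1, z2))) \<in> differential_image (M \<epsilon>) \<Phi> (z1, z2)"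
    (is "?v \<in> _")
proof -
  define \<gamma> where "\<gamma> = (\<lambda>s. (z1 * a s, z2 * b s))"
  have fg: "f (z1, z2) \<noteq> 0" "g (z1, z2) \<noteq> 0"
    using p by (auto simp: milnor_link_def)
  have \<gamma>0: "\<gamma> 0 = (z1, z2)"
    by (simp add: \<gamma>_def a b)
  have "\<gamma> \<in> smooth_curves_at (sphere 0 \<epsilon> - {z \<in> sphere 0 \<epsilon>. f z * g z = 0}) (z1, z2)"
  proof (rule smooth_curves_at_diffI[where \<gamma> = \<gamma>])
    show "smooth_on UNIV \<gamma>"
      unfolding \<gamma>_def by (intro smooth_on_Pair smooth_on_mult smooth_on_const a b open_UNIV)
    show "\<gamma> s \<in> sphere 0 \<epsilon>" for s
      using p sphere[of s] by (simp add: \<gamma>_def norm_Pair norm_mult)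
    show "continuous_on UNIV (\<lambda>z. f z * g z)"
      by (intro continuous_intros smooth_on_imp_continuous_on smooth_on_f smooth_on_g)
  qed (use fg \<gamma>0 in simp_all)
  then have curve: "\<gamma> \<in> smooth_curves_at (M \<epsilon>) (z1, z2)"
    by (simp add: milnor_link_def)
  have pw: "((\<lambda>s. c s ^ n) has_vector_derivative of_nat n * c') (at 0)"
    if "(c has_vector_derivative c') (at 0)" "c 0 = 1" for c :: "real \<Rightarrow> complex" and c' n
    using that has_derivative_power[OF that(1)[unfolded has_vector_derivative_def], of n]
    by (simp add: has_vector_derivative_def mult_ac)
  have "((\<lambda>s. z1 ^ m * a s ^ m + z2 ^ m * b s ^ m) has_vector_derivative
      z1 ^ m * (of_nat m * a') + z2 ^ m * (of_nat m * b')) (at 0)"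
    by (intro has_vector_derivative_add has_vector_derivative_mult_right pw a b)
  then have F: "((\<lambda>s. f (\<gamma> s)) has_vector_derivative of_nat m * (z1 ^ m * a' + z2 ^ m * b')) (at 0)"
    by (simp add: f \<gamma>_def power_mult_distrib algebra_simps)
  have "((\<lambda>s. (z1 * a s) * (z2 * b s)) has_vector_derivative
      (z1 * a 0) * (z2 * b') + (z1 * a') * (z2 * b 0)) (at 0)"
    by (intro has_vector_derivative_mult has_vector_derivative_mult_right a b)
  then have G: "((\<lambda>s. g (\<gamma> s)) has_vector_derivative z1 * z2 * (a' + b')) (at 0)"
    by (simp add: g \<gamma>_def algebra_simps a b)
  have Gq: "z1 * z2 * (a' + b') / g (z1, z2) = a' + b'"
    using fg by (simp add: g)
  have Fq: "f (z1, z2) = z1 ^ m + z2 ^ m"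
    by (simp add: f)
  have "((\<Phi> \<circ> \<gamma>) has_vector_derivative ?v) (at 0)"
    using has_vector_derivative_Pair[OF has_vector_derivative_normalize[OF F] has_vector_derivative_normalize[OF G]]
      fg by (simp only: \<gamma>0 Gq Fq milnor_product_map_def o_def fst_conv snd_conv) simp
  then have "vector_derivative (\<Phi> \<circ> \<gamma>) (at 0) = ?v"
    by (rule vector_derivative_at)
  with curve show ?thesis
    unfolding differential_image_def by (metis image_eqI)
qed

text \<open>Rotating both coordinates by \<open>cis s\<close> moves the angle of \<open>g\<close>
  with speed 2. A nonzero velocity that leaves this angle at rest is therefore independent of the
  velocity of the rotation.\<close>

lemma rank_ge_2:
  assumes p: "(z1, z2) \<in> M \<epsilon>"
    and c: "(\<i> * of_real c * fst (\<Phi> (z1, z2)), 0) \<in> differential_image (M \<epsilon>) \<Phi> (z1, z2)" "c \<noteq> 0"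
  shows "rank_differential (M \<epsilon>) \<Phi> (z1, z2) \<ge> 2"
proof -
  let ?D = "differential_image (M \<epsilon>) \<Phi> (z1, z2)"
  have nz: "fst (\<Phi> (z1, z2)) \<noteq> 0" "snd (\<Phi> (z1, z2)) \<noteq> 0"
    using Phi_in_torus[OF p] by (auto simp: torus_def mem_Times_iff)
  define v where "v = (\<i> * of_real c * fst (\<Phi> (z1, z2)), 0 :: complex)"
  define w where "w = (\<i> * of_real (Im (of_nat m * (z1 ^ m * \<i> + z2 ^ m * \<i>) / (z1 ^ m + z2 ^ m))) * fst (\<Phi> (z1, z2)),
      \<i> * of_real (Im (\<i> + \<i>)) * snd (\<Phi> (z1, z2)))"
  have cis: "(cis has_vector_derivative \<i>) (at 0)"
    using has_vector_derivative_cis_0[of 1] by simp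
  have "w \<in> ?D"
    unfolding w_def
    by (rule velocity_in_differential_image[OF p, of cis _ cis])
      (simp_all add: cis smooth_on_cis smooth_on_cis[OF _ smooth_on_id])
  moreover have "independent {v, w}"
  proof -
    have "w \<noteq> 0"
      using nz by (simp add: w_def prod_eq_iff)
    moreover have "v \<notin> span {w}"
      using nz c(2) by (auto simp: span_singleton v_def w_def)
    ultimately show ?thesis
      by (auto simp: independent_insert)
  qed
  moreover have "v \<noteq> w"
    using nz by (simp add: v_def w_def)
  ultimately show ?thesis
    using c(1) dim_subset[of "{v, w}" ?D] dim_eq_card_independent[of "{v, w}"]
    by (simp add: rank_differential_def v_def[symmetric])
qed

text \<open>At a singular point, every test curve that keeps the angle of \<open>g\<close>
  stationary to first order must do the same for the angle of \<open>f\<close>. Two such curves kill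
  the real and the imaginary part of \<open>(A - B) / (A + B)\<close>.\<close>

lemma singular_point_imp_power_eq:
  assumes sing: "singular_point (M \<epsilon>) \<Phi> (z1, z2)"
  shows "z1 ^ m = z2 ^ m"
proof -
  define A B where "A = z1 ^ m" and "B = z2 ^ m"
  have p: "(z1, z2) \<in> M \<epsilon>"
    using sing by (simp add: singular_point_def)
  have nz: "z1 \<noteq> 0" "z2 \<noteq> 0" "A + B \<noteq> 0"
    using p by (auto simp: milnor_link_def f g A_def B_def)
  have zero: "Im (of_nat m * (A * a' + B * b') / (A + B)) = 0"
    if "(\<i> * of_real (Im (of_nat m * (A * a' + B * b') / (A + B))) * fst (\<Phi> (z1, z2)),
      \<i> * of_real (Im (a' + b')) * snd (\<Phi> (z1, z2))) \<in> differential_image (M \<epsilon>) \<Phi> (z1, z2)"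
      "Im (a' + b') = 0" for a' b'
  proof (rule ccontr)
    assume "Im (of_nat m * (A * a' + B * b') / (A + B)) \<noteq> 0"
    moreover have "(\<i> * of_real (Im (of_nat m * (A * a' + B * b') / (A + B))) * fst (\<Phi> (z1, z2)), 0)
        \<in> differential_image (M \<epsilon>) \<Phi> (z1, z2)"
      using that(1) unfolding that(2) by simp
    ultimately show False
      using rank_ge_2[OF p] sing by (force simp: singular_point_def)
  qed
  have cis: "(cis has_vector_derivative \<i>) (at 0)"
    using has_vector_derivative_cis_0[of 1] by simp
  have cis': "((\<lambda>s. cis (- s)) has_vector_derivative -\<i>) (at 0)"
    using has_vector_derivative_cis_0[of "-1"] by simp
  have "Im (of_nat m * (A * \<i> + B * (-\<i>)) / (A + B)) = 0"
    unfolding A_def B_def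
    by (rule zero[unfolded A_def B_def], rule velocity_in_differential_image[OF p, of cis _ "\<lambda>s. cis (- s)"])
      (simp_all add: cis cis' smooth_on_cis smooth_on_cis[OF _ smooth_on_id] smooth_on_minus)
  moreover have "of_nat m * (A * \<i> + B * (-\<i>)) / (A + B) = of_nat m * (\<i> * ((A - B) / (A + B)))"
    by (simp add: algebra_simps)
  ultimately have "Im (of_nat m * (\<i> * ((A - B) / (A + B)))) = 0"
    by (simp only:)
  then have 1: "Re ((A - B) / (A + B)) = 0"
    using m by (simp del: times_divide_eq_right)
  \<comment> \<open>The numerator is the real part of \<open>(A - B) * cnj (A + B)\<close>, which
    equals \<open>(cmod A)\<^sup>2 - (cmod B)\<^sup>2\<close>. So the opposite rotation forces equal
    moduli.\<close>
  have "Re ((A - B) / (A + B)) = (Re (A - B) * Re (A + B) + Im (A - B) * Im (A + B)) / (cmod (A + B))\<^sup>2"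
    by (simp only: Re_divide cmod_power2)
  then have "Re (A - B) * Re (A + B) + Im (A - B) * Im (A + B) = 0"
    using 1 nz by simp
  then have "(cmod A)\<^sup>2 = (cmod B)\<^sup>2"
    unfolding cmod_power2 by (simp add: power2_eq_square algebra_simps)
  then have "cmod A = cmod B"
    by simp
  then have eq: "cmod z1 = cmod z2"
    using m by (simp add: A_def B_def norm_power power_eq_iff_eq_base)
  \<comment> \<open>This curve shifts length from one coordinate to the other. It stays on the
    sphere because the moduli of \<open>z1\<close> and \<open>z2\<close> are now known to be
    equal.\<close>
  define a b where "a = (\<lambda>s. complex_of_real (cos s - sin s))" and "b = (\<lambda>s. complex_of_real (cos s + sin s))"
  have a: "smooth_on UNIV a" "a 0 = 1" "(a has_vector_derivative -1) (at 0)"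
    and b: "smooth_on UNIV b" "b 0 = 1" "(b has_vector_derivative 1) (at 0)"
    unfolding a_def b_def
    by (auto intro!: smooth_on_of_real smooth_on_add smooth_on_diff smooth_on_cos smooth_on_sin derivative_eq_intros)
  have sphere: "(cmod z1 * cmod (a s))\<^sup>2 + (cmod z2 * cmod (b s))\<^sup>2 = (cmod z1)\<^sup>2 + (cmod z2)\<^sup>2" for s
  proof -
    have "(cos s - sin s)\<^sup>2 + (cos s + sin s)\<^sup>2 = 2 * ((cos s)\<^sup>2 + (sin s)\<^sup>2)"
      by (simp add: power2_eq_square algebra_simps)
    also have "\<dots> = 2"
      by (simp only: sin_cos_squared_add2)
    finally have "(cos s - sin s)\<^sup>2 + (cos s + sin s)\<^sup>2 = 2" .
    then show ?thesis
      using eq by (simp only: a_def b_def norm_of_real power_mult_distrib power2_abs flip: distrib_left)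
  qed
  have "Im (of_nat m * (A * (-1) + B * 1) / (A + B)) = 0"
    unfolding A_def B_def
    by (rule zero[unfolded A_def B_def], rule velocity_in_differential_image[OF p a b sphere]) simp
  moreover have "of_nat m * (A * (-1) + B * 1) / (A + B) = - of_nat m * ((A - B) / (A + B))"
    by (simp add: algebra_simps)
  ultimately have "Im (- of_nat m * ((A - B) / (A + B))) = 0"
    by (simp only:)
  then have "Im ((A - B) / (A + B)) = 0"
    using m by (simp del: times_divide_eq_right)
  with 1 have "(A - B) / (A + B) = 0"
    by (simp add: complex_eq_iff)
  with nz show ?thesis
    by (simp add: A_def B_def)
qed

end

section \<open>Coordinates on the torus and on the sphere\<close>

text \<open>An explicit smooth inverse \<open>G\<close> does the work: it identifies the image of
  \<open>U\<close> with the open set \<open>D\<close>, and \<open>inv_into U X\<close> coincides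
  with \<open>G\<close> there.\<close>

lemma local_coordsI:
  assumes U: "openin (top_of_set M) U" "p \<in> U" and X0: "X p = 0"
    and D: "open D" "\<And>q. q \<in> U \<Longrightarrow> X q \<in> D" "\<And>y. y \<in> D \<Longrightarrow> G y \<in> U"
    and inv: "\<And>q. q \<in> U \<Longrightarrow> G (X q) = q" "\<And>y. y \<in> D \<Longrightarrow> X (G y) = y"
    and smooth: "open W" "U \<subseteq> W" "smooth_on W X" "smooth_on D G"
  shows "local_coords M p U X"
proof -
  have inj: "inj_on X U"
    using inv(1) by (rule inj_on_inverseI)
  have im: "X ` U = D"
    using D(2,3) inv(2) by force
  have "inv_into U X y = G y" if "y \<in> D" for y
    using inv_into_f_eq[OF inj D(3)[OF that] inv(2)[OF that]] .
  with D(1) smooth(4) have "smooth_map D (inv_into U X)"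
    unfolding smooth_map_def by (metis IntD1)
  moreover have "smooth_map U X"
    unfolding smooth_map_def using smooth(1,2,3) by blast
  ultimately show ?thesis
    using U X0 inj im D(1) by (simp add: local_coords_def)
qed

lemma open_Collect_conj_continuous_on:
  fixes h :: "'a::topological_space \<Rightarrow> 'b::topological_space"
  assumes "open S" "continuous_on S h" "open T"
  shows "open {x \<in> S. h x \<in> T}"
  using continuous_open_preimage[OF assms(2,1,3)] by (simp add: vimage_def Int_def)

lemma eq_vector2: "y $ 1 = a \<Longrightarrow> y $ 2 = b \<Longrightarrow> (y :: real ^ 2) = vector [a, b]"
  by (simp add: vec_eq_iff forall_2)

lemma eq_vector3: "y $ 1 = a \<Longrightarrow> y $ 2 = b \<Longrightarrow> y $ 3 = c \<Longrightarrow> (y :: real ^ 3) = vector [a, b, c]"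
  by (simp add: vec_eq_iff forall_3)

text \<open>For \<open>c = m / 2\<close>, the residue at \<open>\<Phi> z\<close> relative to \<open>w = \<Phi> p\<close> is \<open>cosh \<zeta> / |cosh \<zeta>|\<close>.\<close>

definition torus_residue :: "real \<Rightarrow> complex \<times> complex \<Rightarrow> complex \<times> complex \<Rightarrow> complex" where
  "torus_residue c w z = fst z / fst w * exp (- (of_real c * Ln (snd z / snd w)))"

definition torus_chart_dom :: "real \<Rightarrow> complex \<times> complex \<Rightarrow> (complex \<times> complex) set" where
  "torus_chart_dom c w = {z. snd z / snd w \<notin> \<real>\<^sub>\<le>\<^sub>0 \<and> Re (torus_residue c w z) > 0}"

text \<open>The second coordinate is the tangent of the angle of the residue rather than the angle,
  because the tangent factors exactly as a product on the sphere. Positivity of the real part on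
  \<open>torus_chart_dom\<close> makes the angle recoverable from it.\<close>

definition torus_chart :: "real \<Rightarrow> complex \<times> complex \<Rightarrow> complex \<times> complex \<Rightarrow> real ^ 2" where
  "torus_chart c w z =
     vector [Im (Ln (snd z / snd w)), Im (torus_residue c w z) / Re (torus_residue c w z)]"

lemma local_coords_torus_chart:
  assumes w: "w \<in> torus"
  shows "local_coords torus w (torus \<inter> torus_chart_dom c w) (torus_chart c w)"
proof -
  \<comment> \<open>The first coordinate is an angle off the branch cut; the second is a tangent and
    takes every real value.\<close>
  define D :: "(real ^ 2) set" where "D = {y. \<bar>y $ 1\<bar> < pi}"
  \<comment> \<open>After normalization, \<open>e y\<close> is the unit number in the right
    half-plane whose angle has tangent \<open>y $ 2\<close>. It is the residue to be restored by
    \<open>G\<close>.\<close>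
  define e :: "real ^ 2 \<Rightarrow> complex" where "e = (\<lambda>y. 1 + \<i> * of_real (y $ 2))"
  define G where "G = (\<lambda>y. (fst w * (e y / of_real (cmod (e y))) * exp (of_real c * (\<i> * of_real (y $ 1))),
      snd w * exp (\<i> * of_real (y $ 1))))"
  have w1: "cmod (fst w) = 1" "cmod (snd w) = 1"
    using w by (auto simp: torus_def mem_Times_iff)
  then have w0: "fst w \<noteq> 0" "snd w \<noteq> 0"
    by auto
  have e: "e y \<noteq> 0" for y
    by (simp add: e_def complex_eq_iff)
  \<comment> \<open>Off the branch cut \<open>torus_residue\<close> is continuous, so the chart
    domain is an open condition inside this open set.\<close>
  define W1 :: "(complex \<times> complex) set" where "W1 = {z \<in> UNIV. snd z / snd w \<in> - \<real>\<^sub>\<le>\<^sub>0}"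
  have W1: "open W1"
    unfolding W1_def
    by (intro open_Collect_conj_continuous_on continuous_intros open_Compl closed_nonpos_Reals_complex) (use w0 in auto)
  have q: "smooth_on W1 (torus_residue c w)"
    unfolding torus_residue_def divide_inverse[of "fst _"]
    by (intro smooth_on_mult smooth_on_exp smooth_on_minus smooth_on_Ln smooth_on_divide smooth_on_fst smooth_on_snd
        smooth_on_const smooth_on_id W1) (auto simp: W1_def w0)
  have W_eq: "torus_chart_dom c w = {z \<in> W1. torus_residue c w z \<in> {a. Re a > 0}}"
    by (auto simp: torus_chart_dom_def W1_def)
  have W: "open (torus_chart_dom c w)"
    unfolding W_eq
    by (intro open_Collect_conj_continuous_on W1 smooth_on_imp_continuous_on q open_Collect_less continuous_intros)
  have sub: "torus_chart_dom c w \<subseteq> W1"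
    by (auto simp: W_eq)
  show ?thesis
  proof (rule local_coordsI[where D = D and G = G and W = "torus_chart_dom c w"])
    show "openin (top_of_set torus) (torus \<inter> torus_chart_dom c w)"
      using W by (rule openin_open_Int)
    show "w \<in> torus \<inter> torus_chart_dom c w"
      using w w0 by (simp add: torus_chart_dom_def torus_residue_def)
    show "torus_chart c w w = 0"
      using w0 by (simp add: torus_chart_def torus_residue_def vec_eq_iff forall_2)
    show "open D"
      unfolding D_def by (intro open_Collect_less continuous_intros)
    show "torus_chart c w z \<in> D" if "z \<in> torus \<inter> torus_chart_dom c w" for z
    proof -
      have "snd z / snd w \<notin> \<real>\<^sub>\<le>\<^sub>0"
        using that by (auto simp: torus_chart_dom_def)
      moreover have "snd z / snd w \<noteq> 0"
        using calculation by auto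
      ultimately show ?thesis
        using Im_Ln_less_pi[of "snd z / snd w"] mpi_less_Im_Ln[of "snd z / snd w"]
        by (auto simp: D_def torus_chart_def abs_less_iff)
    qed
    show "G y \<in> torus \<inter> torus_chart_dom c w" and "torus_chart c w (G y) = y" if "y \<in> D" for y
    proof -
      have Ln: "Ln (exp (\<i> * of_real (y $ 1))) = \<i> * of_real (y $ 1)"
        using that by (intro Ln_exp) (auto simp: D_def abs_less_iff)
      have v: "snd (G y) / snd w = exp (\<i> * of_real (y $ 1))"
        using w0 by (simp add: G_def)
      have res: "torus_residue c w (G y) = e y / of_real (cmod (e y))"
        unfolding torus_residue_def v Ln using w0 e[of y] by (simp add: G_def exp_minus)
      have "Re (e y) = 1"
        by (simp add: e_def)
      have pos: "Re (e y / of_real (cmod (e y))) = 1 / cmod (e y)" "Im (e y / of_real (cmod (e y))) = y $ 2 / cmod (e y)"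
        by (simp_all add: e_def)
      have "exp (\<i> * of_real (y $ 1)) \<notin> \<real>\<^sub>\<le>\<^sub>0"
        using that sin_eq_0_pi[of "y $ 1"]
        by (auto simp: D_def abs_less_iff complex_nonpos_Reals_iff Re_exp Im_exp)
      then show "G y \<in> torus \<inter> torus_chart_dom c w"
        using e[of y] w1 by (simp add: torus_chart_dom_def v res pos \<open>Re (e y) = 1\<close>)
          (simp add: torus_def G_def norm_mult norm_divide)
      show "torus_chart c w (G y) = y"
        unfolding torus_chart_def v res Ln pos using e[of y]
        by (intro eq_vector2[symmetric]) simp_all
    qed
    show "G (torus_chart c w z) = z" if "z \<in> torus \<inter> torus_chart_dom c w" for z
    proof -
      define a where "a = snd z / snd w"
      define q where "q = torus_residue c w z"
      have z: "cmod (fst z) = 1" "cmod (snd z) = 1" "a \<notin> \<real>\<^sub>\<le>\<^sub>0" "Re q > 0"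
        using that by (auto simp: torus_def mem_Times_iff torus_chart_dom_def a_def q_def)
      have a: "cmod a = 1" "a \<noteq> 0"
        using z w1 by (auto simp: a_def norm_divide)
      have La: "\<i> * of_real (Im (Ln a)) = Ln a"
        using a by (simp add: complex_eq_iff)
      have "cmod q = 1"
        unfolding q_def torus_residue_def a_def[symmetric] using a z w1 by (simp add: norm_mult norm_divide)
      \<comment> \<open>Dividing \<open>q\<close> by its positive real part is a positive rescaling,
        and normalizing undoes it because \<open>cmod q = 1\<close>.\<close>
      have "1 + \<i> * of_real (Im q / Re q) = of_real (1 / Re q) * q"
        using z(4) by (simp add: complex_eq_iff)
      then have e: "e (torus_chart c w z) = of_real (1 / Re q) * q"
        by (simp add: e_def torus_chart_def q_def)
      have "e (torus_chart c w z) / of_real (cmod (e (torus_chart c w z))) = q"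
        unfolding e norm_mult \<open>cmod q = 1\<close> norm_of_real using z(4) by simp
      moreover have "torus_chart c w z $ 1 = Im (Ln a)"
        by (simp add: torus_chart_def a_def)
      moreover have "fst w * q * exp (of_real c * Ln a) = fst z"
        unfolding q_def torus_residue_def a_def[symmetric] using w0 by (simp add: exp_minus)
      moreover have "snd w * exp (Ln a) = snd z"
        using a w0 by (simp add: a_def)
      ultimately show ?thesis
        by (simp only: G_def La prod.collapse)
    qed
    show "open (torus_chart_dom c w)"
      by (fact W)
    show "smooth_on (torus_chart_dom c w) (torus_chart c w)"
      unfolding torus_chart_def
    proof (intro smooth_on_vector2 W smooth_on_Im smooth_on_Re smooth_on_divide_real smooth_on_Ln smooth_on_divide
        smooth_on_snd smooth_on_id smooth_on_const smooth_on_subset[OF q] sub)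
    qed (use w0 in \<open>auto simp: torus_chart_dom_def\<close>)
    show "smooth_on D G"
      unfolding G_def e_def
      by (intro smooth_on_Pair smooth_on_mult smooth_on_normalize smooth_on_add smooth_on_exp smooth_on_of_real
          smooth_on_vec_nth smooth_on_const smooth_on_id \<open>open D\<close>) (use e in \<open>simp add: e_def\<close>)
  qed auto
qed

section \<open>Logarithmic coordinates on the sphere\<close>

lemma tanh_artanh_real:
  fixes t :: real
  assumes "\<bar>t\<bar> < 1"
  shows "tanh (artanh t) = t"
proof -
  have t: "1 + t > 0" "1 - t > 0"
    using assms by auto
  have "exp (- 2 * artanh t) = inverse ((1 + t) / (1 - t))"
    using t by (simp add: artanh_def exp_minus)
  also have "\<dots> = (1 - t) / (1 + t)"
    by simp
  finally have e: "exp (- 2 * artanh t) = (1 - t) / (1 + t)" .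
  have "1 - (1 - t) / (1 + t) = 2 * t / (1 + t)" "1 + (1 - t) / (1 + t) = 2 / (1 + t)"
    using t by (simp_all add: field_simps)
  then show ?thesis
    unfolding tanh_real_altdef e using t by simp
qed

text \<open>With \<open>u = Re L1\<close> and \<open>v = Re L2\<close>, the left side of the sphere
  equation is \<open>2 * exp (u + v) * cosh (u - v)\<close>. Hence \<open>u + v\<close> is
  determined by \<open>u - v\<close>, which leaves three free real parameters among the four of
  \<open>L1\<close> and \<open>L2\<close>.\<close>

lemma sphere_chart_scale:
  fixes L1 L2 :: complex
  assumes "(exp (Re L1))\<^sup>2 + (exp (Re L2))\<^sup>2 = 2"
  shows "ln (cosh (Re (L1 - L2))) = - (Re L1 + Re L2)"
proof -
  have "exp (Re L1 + Re L2) * cosh (Re (L1 - L2)) = ((exp (Re L1))\<^sup>2 + (exp (Re L2))\<^sup>2) / 2"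
    by (simp add: cosh_field_def algebra_simps power2_eq_square flip: exp_add)
  then have "cosh (Re (L1 - L2)) = exp (- (Re L1 + Re L2))"
    using assms by (simp only: exp_minus) (simp add: field_simps)
  then show ?thesis
    by (simp only: ln_exp)
qed

text \<open>For \<open>c = m / 2\<close> this is the \<open>\<zeta>\<close> of the overview.\<close>

definition log_ratio :: "real \<Rightarrow> complex \<times> complex \<Rightarrow> complex \<times> complex \<Rightarrow> complex" where
  "log_ratio c p z = of_real c * (Ln (fst z / fst p) - Ln (snd z / snd p))"

definition arg_sum :: "complex \<times> complex \<Rightarrow> complex \<times> complex \<Rightarrow> real" where
  "arg_sum p z = Im (Ln (fst z / fst p) + Ln (snd z / snd p))"

text \<open>The bound on \<open>arg_sum\<close> makes it the principal argument of
  \<open>g z / g p\<close>. The bound on the imaginary part of \<open>log_ratio\<close> keeps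
  \<open>tan\<close> finite and invertible by \<open>arctan\<close>, and puts \<open>cosh\<close> of
  \<open>log_ratio\<close> in the right half-plane.\<close>

definition sphere_chart_dom :: "real \<Rightarrow> complex \<times> complex \<Rightarrow> (complex \<times> complex) set" where
  "sphere_chart_dom c p = {z. fst z / fst p \<notin> \<real>\<^sub>\<le>\<^sub>0 \<and> snd z / snd p \<notin> \<real>\<^sub>\<le>\<^sub>0 \<and>
     \<bar>arg_sum p z\<bar> < pi \<and> \<bar>Im (log_ratio c p z)\<bar> < pi / 2}"

definition sphere_chart :: "real \<Rightarrow> complex \<times> complex \<Rightarrow> complex \<times> complex \<Rightarrow> real ^ 3" where
  "sphere_chart c p z =
     vector [(tanh (Re (log_ratio c p z)) - tan (Im (log_ratio c p z))) / 2,
             (tanh (Re (log_ratio c p z)) + tan (Im (log_ratio c p z))) / 2,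
             arg_sum p z]"

text \<open>The inverse recovers \<open>log_ratio\<close> from the sum and the difference of the
  first two coordinates, the total angle from the third, and the remaining radial parameter from the
  sphere equation. The set \<open>N\<close> will be the complement of the link.\<close>

lemma local_coords_sphere_chart:
  assumes c: "c \<ge> 1" and p0: "cmod (fst p) = r" "cmod (snd p) = r" "r > 0" and p: "p \<in> sphere 0 \<epsilon>" "p \<in> N"
    and N: "N \<subseteq> sphere 0 \<epsilon>" "sphere 0 \<epsilon> \<inter> sphere_chart_dom c p \<subseteq> N"
  shows "local_coords N p (N \<inter> sphere_chart_dom c p) (sphere_chart c p)"
proof -
  \<comment> \<open>The sum \<open>x $ 1 + x $ 2\<close> is a value of \<open>tanh\<close>, while
    \<open>x $ 2 - x $ 1\<close> is a value of \<open>tan\<close> and hence unrestricted.\<close>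
  define D :: "(real ^ 3) set" where "D = {x. \<bar>x $ 1 + x $ 2\<bar> < 1} \<inter> {x. \<bar>x $ 3\<bar> < pi}"
  \<comment> \<open>With \<open>L1\<close>, \<open>L2\<close> the logarithms of the coordinate
    quotients, \<open>a\<close> is \<open>(L1 - L2) / 2\<close>, and \<open>s\<close> below is
    \<open>(Re L1 + Re L2) / 2\<close> as dictated by \<open>sphere_chart_scale\<close>.\<close>
  define a where "a = (\<lambda>x :: real ^ 3. (of_real (artanh (x $ 1 + x $ 2)) + \<i> * of_real (arctan (x $ 2 - x $ 1)))
    / of_real (2 * c))"
  define s where "s = (\<lambda>x. - ln (cosh (2 * Re (a x))) / 2)"
  define G where "G = (\<lambda>x. (fst p * exp (a x + \<i> * of_real (x $ 3 / 2) + of_real (s x)),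
      snd p * exp (- a x + \<i> * of_real (x $ 3 / 2) + of_real (s x))))"
  have nz: "fst p \<noteq> 0" "snd p \<noteq> 0"
    using p0 by auto
  have \<epsilon>: "sqrt (r\<^sup>2 + r\<^sup>2) = \<epsilon>"
    using p p0 by (simp add: norm_prod_def)
  define W1 :: "(complex \<times> complex) set" where
    "W1 = {z \<in> UNIV. fst z / fst p \<in> - \<real>\<^sub>\<le>\<^sub>0} \<inter> {z \<in> UNIV. snd z / snd p \<in> - \<real>\<^sub>\<le>\<^sub>0}"
  have W1: "open W1"
    unfolding W1_def
    by (intro open_Int open_Collect_conj_continuous_on continuous_intros open_Compl closed_nonpos_Reals_complex)
      (use nz in auto)
  have smooth: "smooth_on W1 (log_ratio c p)" "smooth_on W1 (arg_sum p)"
    unfolding log_ratio_def arg_sum_def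
    by (intro smooth_on_mult smooth_on_diff smooth_on_add smooth_on_Im smooth_on_Ln smooth_on_divide smooth_on_fst
        smooth_on_snd smooth_on_const smooth_on_id W1; use nz in \<open>auto simp: W1_def\<close>)+
  have W_eq: "sphere_chart_dom c p = {z \<in> W1. arg_sum p z \<in> {y. \<bar>y\<bar> < pi}} \<inter>
      {z \<in> W1. log_ratio c p z \<in> {y. \<bar>Im y\<bar> < pi / 2}}"
    by (auto simp: sphere_chart_dom_def W1_def)
  have W: "open (sphere_chart_dom c p)"
    unfolding W_eq
    by (intro open_Int open_Collect_conj_continuous_on W1 smooth_on_imp_continuous_on smooth open_Collect_less
        continuous_intros)
  have sub: "sphere_chart_dom c p \<subseteq> W1"
    by (auto simp: W_eq)
  have cos: "cos (Im (log_ratio c p z)) \<noteq> 0" if "z \<in> sphere_chart_dom c p" for z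
  proof -
    have "\<bar>Im (log_ratio c p z)\<bar> < pi / 2"
      using that by (simp add: sphere_chart_dom_def)
    then show ?thesis
      using cos_gt_zero_pi[of "Im (log_ratio c p z)"] by linarith
  qed
  show ?thesis
  proof (rule local_coordsI[where D = D and G = G and W = "sphere_chart_dom c p"])
    show "openin (top_of_set N) (N \<inter> sphere_chart_dom c p)"
      using W by (rule openin_open_Int)
    show "p \<in> N \<inter> sphere_chart_dom c p"
      using p nz by (simp add: sphere_chart_dom_def arg_sum_def log_ratio_def)
    show "sphere_chart c p p = 0"
      using nz by (simp add: sphere_chart_def arg_sum_def log_ratio_def vec_eq_iff forall_3)
    show "open D"
      unfolding D_def by (intro open_Int open_Collect_less continuous_intros)
    show "sphere_chart c p z \<in> D" if "z \<in> N \<inter> sphere_chart_dom c p" for z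
    proof -
      have "sphere_chart c p z $ 1 + sphere_chart c p z $ 2 = tanh (Re (log_ratio c p z))"
        by (simp add: sphere_chart_def field_simps)
      moreover have "sphere_chart c p z $ 3 = arg_sum p z"
        by (simp add: sphere_chart_def)
      ultimately show ?thesis
        using that tanh_real_lt_1[of "Re (log_ratio c p z)"] tanh_real_gt_neg1[of "Re (log_ratio c p z)"]
        by (simp add: D_def sphere_chart_dom_def abs_less_iff)
    qed
    show "G x \<in> N \<inter> sphere_chart_dom c p" and "sphere_chart c p (G x) = x" if x: "x \<in> D" for x
    proof -
      define L1 L2 where "L1 = a x + \<i> * of_real (x $ 3 / 2) + of_real (s x)"
        and "L2 = - a x + \<i> * of_real (x $ 3 / 2) + of_real (s x)"
      have a: "Re (a x) = artanh (x $ 1 + x $ 2) / (2 * c)" "Im (a x) = arctan (x $ 2 - x $ 1) / (2 * c)"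
        by (simp_all add: a_def Re_divide_of_real Im_divide_of_real del: of_real_mult)
      have arctan: "\<bar>arctan (x $ 2 - x $ 1)\<bar> < pi / 2"
        using arctan_bounded[of "x $ 2 - x $ 1"] by linarith
      \<comment> \<open>Here \<open>c \<ge> 1\<close> enters: the imaginary parts of
        \<open>a x\<close> and of the rotation term are each below \<open>pi / 2\<close> in modulus,
        so those of \<open>L1\<close> and \<open>L2\<close> are below \<open>pi\<close> and
        \<open>Ln\<close> inverts \<open>exp\<close>.\<close>
      moreover have "\<bar>arctan (x $ 2 - x $ 1)\<bar> / (2 * c) \<le> \<bar>arctan (x $ 2 - x $ 1)\<bar> / 1"
        using c by (intro divide_left_mono) auto
      ultimately have "\<bar>Im (a x)\<bar> < pi / 2"
        using c by (simp add: a abs_divide)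
      moreover have "\<bar>x $ 3\<bar> < pi"
        using x by (simp add: D_def)
      ultimately have Im: "\<bar>Im L1\<bar> < pi" "\<bar>Im L2\<bar> < pi"
        by (auto simp: L1_def L2_def)
      then have Ln: "Ln (exp L1) = L1" "Ln (exp L2) = L2"
        by (auto simp: abs_less_iff intro!: Ln_exp)
      have w: "fst (G x) / fst p = exp L1" "snd (G x) / snd p = exp L2"
        using nz by (simp_all add: G_def L1_def L2_def)
      have "log_ratio c p (G x) = of_real (2 * c) * a x"
        by (simp add: log_ratio_def w Ln) (simp add: L1_def L2_def)
      then have lr: "log_ratio c p (G x) = of_real (artanh (x $ 1 + x $ 2)) + \<i> * of_real (arctan (x $ 2 - x $ 1))"
        using c by (simp add: a_def)
      have as: "arg_sum p (G x) = x $ 3"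
        by (simp add: arg_sum_def w Ln) (simp add: L1_def L2_def)
      have exp_notin: "exp L \<notin> \<real>\<^sub>\<le>\<^sub>0" if "\<bar>Im L\<bar> < pi" for L
        using that sin_eq_0_pi[of "Im L"]
        by (auto simp: abs_less_iff complex_nonpos_Reals_iff Re_exp Im_exp mult_le_0_iff)
      have "G x \<in> sphere_chart_dom c p"
        using exp_notin[OF Im(1)] exp_notin[OF Im(2)] x arctan
        by (simp add: sphere_chart_dom_def w as lr D_def)
      moreover have "G x \<in> sphere 0 \<epsilon>"
      proof -
        \<comment> \<open>This is the sphere equation in logarithmic form; \<open>s\<close> was
          chosen to satisfy it.\<close>
        have "exp (2 * s x) * cosh (2 * Re (a x)) = 1"
          by (simp add: s_def exp_minus)
        then have 1: "(exp (Re L1))\<^sup>2 + (exp (Re L2))\<^sup>2 = 2"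
          by (simp add: L1_def L2_def cosh_field_def exp_add[symmetric] exp_double[symmetric] algebra_simps)
        have "G x = (fst p * exp L1, snd p * exp L2)"
          by (simp only: G_def L1_def L2_def)
        then have "norm (G x) = sqrt (r\<^sup>2 * ((exp (Re L1))\<^sup>2 + (exp (Re L2))\<^sup>2))"
          by (simp add: norm_prod_def norm_mult p0 power_mult_distrib distrib_left)
        then show ?thesis
          unfolding 1 using \<epsilon> by (simp add: mult.commute)
      qed
      ultimately show "G x \<in> N \<inter> sphere_chart_dom c p"
        using N by auto
      have "\<bar>x $ 1 + x $ 2\<bar> < 1"
        using x by (simp add: D_def)
      then have "tanh (artanh (x $ 1 + x $ 2)) = x $ 1 + x $ 2"
        by (rule tanh_artanh_real)
      then show "sphere_chart c p (G x) = x"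
        unfolding sphere_chart_def lr as
        by (intro eq_vector3[symmetric]) (simp_all add: tan_arctan)
    qed
    show "G (sphere_chart c p z) = z" if "z \<in> N \<inter> sphere_chart_dom c p" for z
    proof -
      define x where "x = sphere_chart c p z"
      define L1 L2 where "L1 = Ln (fst z / fst p)" and "L2 = Ln (snd z / snd p)"
      have z: "fst z / fst p \<noteq> 0" "snd z / snd p \<noteq> 0" "\<bar>Im (log_ratio c p z)\<bar> < pi / 2" "norm z = \<epsilon>"
        using that N by (auto simp: sphere_chart_dom_def)
      have w: "exp L1 = fst z / fst p" "exp L2 = snd z / snd p"
        unfolding L1_def L2_def using z by simp_all
      have "a x = log_ratio c p z / of_real (2 * c)"
      proof -
        have "x $ 1 + x $ 2 = tanh (Re (log_ratio c p z))" "x $ 2 - x $ 1 = tan (Im (log_ratio c p z))"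
          by (simp_all add: x_def sphere_chart_def field_simps)
        moreover have "arctan (tan (Im (log_ratio c p z))) = Im (log_ratio c p z)"
          using z(3) by (intro arctan_tan) auto
        ultimately have "a x = (of_real (Re (log_ratio c p z)) + \<i> * of_real (Im (log_ratio c p z))) / of_real (2 * c)"
          unfolding a_def by (simp only: artanh_tanh_real)
        then show ?thesis
          by (simp only: complex_eq[symmetric])
      qed
      then have a: "a x = (L1 - L2) / 2"
        using c by (simp add: log_ratio_def L1_def L2_def)
      have x3: "x $ 3 = Im L1 + Im L2"
        by (simp add: x_def sphere_chart_def arg_sum_def L1_def L2_def)
      have "(exp (Re L1))\<^sup>2 = (cmod (fst z))\<^sup>2 / r\<^sup>2" "(exp (Re L2))\<^sup>2 = (cmod (snd z))\<^sup>2 / r\<^sup>2"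
        by (simp_all add: norm_exp_eq_Re[symmetric] w norm_divide p0 power_divide)
      moreover have "(cmod (fst z))\<^sup>2 + (cmod (snd z))\<^sup>2 = 2 * r\<^sup>2"
      proof -
        have "(norm z)\<^sup>2 = (cmod (fst z))\<^sup>2 + (cmod (snd z))\<^sup>2"
          by (simp add: norm_prod_def)
        moreover have "\<epsilon>\<^sup>2 = 2 * r\<^sup>2"
          unfolding \<epsilon>[symmetric] by simp
        ultimately show ?thesis
          using z by simp
      qed
      ultimately have norms: "(exp (Re L1))\<^sup>2 + (exp (Re L2))\<^sup>2 = 2"
        using p0(3) by (simp flip: add_divide_distrib)
      have Re_a: "2 * Re (a x) = Re (L1 - L2)"
        by (simp add: a)
      have s: "s x = (Re L1 + Re L2) / 2"
        unfolding s_def Re_a sphere_chart_scale[OF norms] by simp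
      have "a x + \<i> * of_real (x $ 3 / 2) + of_real (s x) = L1" "- a x + \<i> * of_real (x $ 3 / 2) + of_real (s x) = L2"
        by (simp_all add: a x3 s complex_eq_iff field_simps)
      then have "G x = (fst p * exp L1, snd p * exp L2)"
        by (simp add: G_def)
      then show ?thesis
        using nz by (simp add: x_def w)
    qed
    show "open (sphere_chart_dom c p)"
      by (fact W)
    show "smooth_on (sphere_chart_dom c p) (sphere_chart c p)"
      unfolding sphere_chart_def
      by (intro smooth_on_vector3 W smooth_on_divide_real smooth_on_tanh_real smooth_on_tan_real smooth_on_add
          smooth_on_diff smooth_on_Re smooth_on_Im smooth_on_const smooth_on_subset[OF smooth(1) sub]
          smooth_on_subset[OF smooth(2) sub] cos) simp_all
    show "smooth_on D G"
    proof -
      have "smooth_on D a"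
        unfolding a_def
        by (intro smooth_on_divide smooth_on_add smooth_on_mult smooth_on_of_real smooth_on_artanh_real smooth_on_arctan
            smooth_on_diff smooth_on_vec_nth smooth_on_const smooth_on_id \<open>open D\<close>) (use c in \<open>auto simp: D_def\<close>)
      then have "smooth_on D s"
        unfolding s_def
        by (intro smooth_on_divide_real smooth_on_minus smooth_on_ln_real smooth_on_cosh_real smooth_on_mult smooth_on_Re
            smooth_on_const \<open>open D\<close>) auto
      then show ?thesis
        unfolding G_def
        by (intro smooth_on_Pair smooth_on_mult smooth_on_exp smooth_on_add smooth_on_minus smooth_on_of_real
            smooth_on_divide_real smooth_on_vec_nth smooth_on_const smooth_on_id \<open>open D\<close> \<open>smooth_on D a\<close>) auto
    qed
  qed auto
qed

section \<open>The normal form\<close>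

context product_pair
begin

text \<open>The two charts share the constant \<open>c = m / 2\<close>, so the factor
  \<open>exp (c * (L1 + L2))\<close> of \<open>f z / f p\<close> contributes to the residue neither
  modulus nor phase. Only \<open>cosh \<zeta>\<close> is left, and the tangent of its angle is the
  saddle.\<close>

lemma fold_point_of_index_1:
  assumes sing: "singular_point (M \<epsilon>) \<Phi> p"
  shows "fold_point_of_index (M \<epsilon>) torus \<Phi> p 1"
proof -
  define c where "c = real m / 2"
  obtain p1 p2 where p12: "p = (p1, p2)"
    by (cases p)
  have pM: "p \<in> M \<epsilon>"
    using sing by (simp add: singular_point_def)
  have pow: "p1 ^ m = p2 ^ m"
    using sing singular_point_imp_power_eq by (simp add: p12)
  then have "cmod p1 ^ m = cmod p2 ^ m"
    by (simp flip: norm_power)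
  then have cmod: "cmod p2 = cmod p1"
    using m by (simp add: power_eq_iff_eq_base)
  have nz: "p1 \<noteq> 0" "p2 \<noteq> 0"
    using pM by (auto simp: milnor_link_def f g p12)
  have c: "c \<ge> 1"
    using m by (simp add: c_def)
  define x where "x = sphere_chart c p"
  define y where "y = torus_chart c (\<Phi> p)"
  have fp: "f p = 2 * p1 ^ m" and gp: "g p = p1 * p2"
    by (simp_all add: f g p12 pow)
  have key: "z \<in> M \<epsilon> \<and> \<Phi> z \<in> torus_chart_dom c (\<Phi> p) \<and>
      y (\<Phi> z) $ 1 = x z $ 3 \<and> y (\<Phi> z) $ 2 = fold_form 1 (x z)"
    if z: "z \<in> sphere 0 \<epsilon>" "z \<in> sphere_chart_dom c p" for z
  proof -
    define L1 L2 where "L1 = Ln (fst z / p1)" and "L2 = Ln (snd z / p2)"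
    define \<zeta> where "\<zeta> = of_real c * (L1 - L2)"
    define \<theta> where "\<theta> = Im (L1 + L2)"
    have dom: "fst z / p1 \<noteq> 0" "snd z / p2 \<noteq> 0" "\<bar>\<theta>\<bar> < pi" "\<bar>Im \<zeta>\<bar> < pi / 2"
      using z(2) by (auto simp: sphere_chart_dom_def log_ratio_def arg_sum_def p12 L1_def L2_def \<zeta>_def \<theta>_def)
    have w: "fst z = p1 * exp L1" "snd z = p2 * exp L2"
      unfolding L1_def L2_def using dom nz by simp_all
    have gz: "g z = g p * exp (L1 + L2)"
      by (simp add: g p12 w case_prod_unfold exp_add)
    \<comment> \<open>Because \<open>p1 ^ m = p2 ^ m\<close>, both summands of \<open>f z\<close>
      share this factor; their exponents \<open>m * L1\<close> and \<open>m * L2\<close> are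
      \<open>c * (L1 + L2)\<close> plus and minus \<open>\<zeta>\<close>.\<close>
    have fz: "f z = f p * (exp (of_real c * (L1 + L2)) * cosh \<zeta>)"
    proof -
      have e1: "exp L1 ^ m = exp (of_real c * (L1 + L2)) * exp \<zeta>"
        by (simp add: \<zeta>_def c_def exp_of_nat_mult[symmetric] exp_add[symmetric] field_simps)
      have e2: "exp L2 ^ m = exp (of_real c * (L1 + L2)) * exp (- \<zeta>)"
        by (simp add: \<zeta>_def c_def exp_of_nat_mult[symmetric] exp_add[symmetric] field_simps)
      show ?thesis
        by (simp add: f p12 case_prod_unfold w power_mult_distrib pow e1 e2 cosh_field_def field_simps)
    qed
    have Re_cosh: "Re (cosh \<zeta>) = cosh (Re \<zeta>) * cos (Im \<zeta>)" and Im_cosh: "Im (cosh \<zeta>) = sinh (Re \<zeta>) * sin (Im \<zeta>)"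
      by (simp_all add: cosh_field_def sinh_field_def Re_exp Im_exp field_simps)
    have cos: "cos (Im \<zeta>) > 0"
      using dom(4) by (intro cos_gt_zero_pi) auto
    then have pos: "Re (cosh \<zeta>) > 0"
      by (simp add: Re_cosh)
    then have cosh: "cosh \<zeta> \<noteq> 0"
      by auto
    \<comment> \<open>Since \<open>cosh \<zeta>\<close> does not vanish, the part of the sphere in
      the chart domain avoids the link, as \<open>local_coords_sphere_chart\<close> requires of
      \<open>N\<close>.\<close>
    have zM: "z \<in> M \<epsilon>"
      using z(1) nz cosh by (simp add: milnor_link_def fz gz fp gp)
    have "exp (L1 + L2) / of_real (cmod (exp (L1 + L2))) = exp (\<i> * of_real \<theta>)"
      by (simp add: norm_exp_eq_Re exp_of_real[symmetric] exp_diff[symmetric] \<theta>_def del: exp_of_real)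
        (simp add: complex_eq_iff Re_exp Im_exp)
    then have v: "snd (\<Phi> z) / snd (\<Phi> p) = exp (\<i> * of_real \<theta>)"
      using nz by (simp add: milnor_product_map_def gz gp norm_mult)
    have Ln: "Ln (exp (\<i> * of_real \<theta>)) = \<i> * of_real \<theta>"
      using dom(3) by (intro Ln_exp) auto
    have vdom: "exp (\<i> * of_real \<theta>) \<notin> \<real>\<^sub>\<le>\<^sub>0"
      using dom(3) sin_eq_0_pi[of \<theta>] by (auto simp: abs_less_iff complex_nonpos_Reals_iff Re_exp Im_exp)
    \<comment> \<open>The positive factor \<open>exp (c * Re (L1 + L2))\<close> is removed by
      normalization, and the phase \<open>exp (c * \<i> * \<theta>)\<close> by the exponential in
      \<open>torus_residue\<close>.\<close>
    have res: "torus_residue c (\<Phi> p) (\<Phi> z) = cosh \<zeta> / of_real (cmod (cosh \<zeta>))"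
    proof -
      have "fst (\<Phi> z) / fst (\<Phi> p) = exp (of_real c * (L1 + L2)) * cosh \<zeta> /
          of_real (cmod (exp (of_real c * (L1 + L2)) * cosh \<zeta>))"
        using nz by (simp add: milnor_product_map_def fz fp norm_mult)
      moreover have "of_real c * (L1 + L2) = of_real (c * Re (L1 + L2)) + of_real c * (\<i> * of_real \<theta>)"
        by (simp add: \<theta>_def complex_eq_iff)
      then have "exp (of_real c * (L1 + L2)) = of_real (exp (c * Re (L1 + L2))) * exp (of_real c * (\<i> * of_real \<theta>))"
        by (simp only: exp_add exp_of_real)
      moreover have "cmod (exp (of_real c * (L1 + L2))) = exp (c * Re (L1 + L2))"
        by (simp add: norm_exp_eq_Re)
      ultimately show ?thesis
        by (simp only: torus_residue_def v Ln norm_mult) (simp add: exp_minus)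
    qed
    have nrm: "cmod (cosh \<zeta>) > 0"
      using cosh by simp
    have "Im (cosh \<zeta>) / Re (cosh \<zeta>) = tanh (Re \<zeta>) * tan (Im \<zeta>)"
      by (simp add: Re_cosh Im_cosh tanh_def tan_def)
    moreover have "fold_form 1 (x z) = tanh (Re \<zeta>) * tan (Im \<zeta>)"
      by (simp add: fold_form_def x_def sphere_chart_def log_ratio_def p12 \<zeta>_def L1_def L2_def)
        (simp add: power2_eq_square field_simps)
    moreover have "y (\<Phi> z) $ 1 = \<theta>" "y (\<Phi> z) $ 2 = Im (cosh \<zeta>) / Re (cosh \<zeta>)"
      unfolding y_def torus_chart_def v res Ln using nrm by simp_all
    moreover have "x z $ 3 = \<theta>"
      by (simp add: x_def sphere_chart_def arg_sum_def \<theta>_def p12 L1_def L2_def)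
    moreover have "\<Phi> z \<in> torus_chart_dom c (\<Phi> p)"
      unfolding torus_chart_dom_def mem_Collect_eq v res using vdom pos nrm by simp
    ultimately show ?thesis
      using zM by simp
  qed
  have "local_coords (M \<epsilon>) p (M \<epsilon> \<inter> sphere_chart_dom c p) x"
    unfolding x_def
  proof (rule local_coords_sphere_chart[OF c])
    show "sphere 0 \<epsilon> \<inter> sphere_chart_dom c p \<subseteq> M \<epsilon>"
      using key by blast
  qed (use pM nz cmod in \<open>auto simp: p12\<close>)
  moreover have "local_coords torus (\<Phi> p) (torus \<inter> torus_chart_dom c (\<Phi> p)) y"
    unfolding y_def by (rule local_coords_torus_chart[OF Phi_in_torus[OF pM]])
  moreover have "\<Phi> ` (M \<epsilon> \<inter> sphere_chart_dom c p) \<subseteq> torus \<inter> torus_chart_dom c (\<Phi> p)"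
    using key Phi_in_torus by blast
  ultimately show ?thesis
    unfolding fold_point_of_index_def using sing key by (intro conjI exI) auto
qed

end

theorem proposition4p2:
  fixes m :: nat and f g :: "complex \<times> complex \<Rightarrow> complex"
  assumes "m \<ge> 2"
    and "f = (\<lambda>(z1, z2). z1 ^ m + z2 ^ m)"
    and "g = (\<lambda>(z1, z2). z1 * z2)"
  shows "\<exists>\<epsilon>0>0. \<forall>\<epsilon>. 0 < \<epsilon> \<and> \<epsilon> \<le> \<epsilon>0 \<longrightarrow>
           (let M = sphere 0 \<epsilon> - milnor_link f g \<epsilon>; \<Phi> = milnor_product_map f g
            in fold_map M torus \<Phi> \<and>
               (\<forall>p. fold_point M torus \<Phi> p \<longrightarrow> fold_point_of_index M torus \<Phi> p 1))"
proof -
  interpret product_pair m f g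
    using assms by unfold_locales
  have "fold_map (M \<epsilon>) torus \<Phi>" for \<epsilon>
    unfolding fold_map_def fold_point_def
    using smooth_map_Phi Phi_in_torus fold_point_of_index_1 by blast
  \<comment> \<open>A fold point of whatever index is singular by definition, and every singular
    point has the saddle form.\<close>
  moreover have "fold_point_of_index (M \<epsilon>) torus \<Phi> p 1" if "fold_point (M \<epsilon>) torus \<Phi> p" for \<epsilon> p
    using that by (intro fold_point_of_index_1) (auto simp: fold_point_def fold_point_of_index_def)
  \<comment> \<open>Both facts hold for every \<open>\<epsilon>\<close>, so the bound 1 is an
    arbitrary positive choice.\<close>
  ultimately show ?thesis
    unfolding Let_def by (intro exI[of _ 1]) auto
qed

end
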